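(* Let $\mathbb{F}\in\{\mathbb{R},\mathbb{C}\}$, $A\in\mathbb{F}^{m\times n}$ with $\|A\|_{\infty,col}\le1$, $\mu>0$, $x_0\in\mathbb{F}^n$ with $S=\mathrm{supp}\,x_0$ and $\#S=K$, $\epsilon\in\mathbb{F}^m$, $b=Ax_0+\epsilon$, and let $N\ge1$ with $\beta_N>0$ and $\beta_K>0$. Let $x'=x_S$ be the oracle solution and $z'=(I-A^*A)x'+A^*b$. If $\|\epsilon\|_2<\beta_N^2\sqrt{\mu}$ and $$|x_{0,j}|>\frac{\sqrt{\mu}}{\beta_N^2}+\frac{\beta_N^2\sqrt{\mu}}{\beta_K}\quad\text{for all }j\in S,$$ then $|z'_i|\notin\big[\beta_N^2\sqrt{\mu},\ \sqrt{\mu}/\beta_N^2\big]$ for all $1\le i\le n$.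
   Context: $\|A\|_{\infty,col}=\max_i\|a_i\|_2$ over the columns $a_i$ of $A$. $\mathrm{card}(x)$ is the number of nonzero entries; $\beta_k=\inf\{\|Ax\|_2/\|x\|_2:x\ne0,\ \mathrm{card}(x)\le k\}$. $A_S$ denotes $A$ with all columns with index outside $S$ set to zero, and the oracle solution is $x_S=(A_S^*A_S)^\dagger A_S^*b$, where $\dagger$ is the Moore–Penrose inverse and $A^*$ the conjugate transpose. *)

theory Defs
  imports "HOL-Analysis.Analysis"
begin

(* The scalar field F is modelled as a subset of the complex numbers:
  either the reals (\<real>) or all of \<complex> (UNIV). All data take entries in F. *)

definition in_field :: "complex set \<Rightarrow> complex ^ 'n \<Rightarrow> bool" where
  "in_field F x \<longleftrightarrow> (\<forall>i. x $ i \<in> F)"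

definition mat_in_field :: "complex set \<Rightarrow> complex ^ 'n ^ 'm \<Rightarrow> bool" where
  "mat_in_field F A \<longleftrightarrow> (\<forall>i j. A $ i $ j \<in> F)"

(* Conjugate transpose. *)
definition adjm :: "complex ^ 'n ^ 'm \<Rightarrow> complex ^ 'm ^ 'n" where
  "adjm A = transpose (map_matrix cnj A)"

(* Moore--Penrose inverse: the unique matrix satisfying the four Penrose equations. *)
definition pinv :: "complex ^ 'n ^ 'm \<Rightarrow> complex ^ 'm ^ 'n" where
  "pinv M = (THE X. M ** X ** M = M \<and> X ** M ** X = X \<and>
                    adjm (M ** X) = M ** X \<and> adjm (X ** M) = X ** M)"

(* Column-wise infinity norm: maximum Euclidean norm of a column. *)
definition col_inf_norm :: "complex ^ 'n ^ 'm \<Rightarrow> real" where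
  "col_inf_norm A = Max (range (\<lambda>j. norm (column j A)))"

definition cardv :: "complex ^ 'n \<Rightarrow> nat" where
  "cardv x = card {i. x $ i \<noteq> 0}"

definition supp :: "complex ^ 'n \<Rightarrow> 'n set" where
  "supp x = {i. x $ i \<noteq> 0}"

(* Restricted lower isometry constant beta_k, infimum over nonzero vectors in F^n. *)
definition beta :: "complex set \<Rightarrow> complex ^ 'n ^ 'm \<Rightarrow> nat \<Rightarrow> real" where
  "beta F A k = Inf {norm (A *v x) / norm x | x. in_field F x \<and> x \<noteq> 0 \<and> cardv x \<le> k}"

(* A_S: columns with index outside S set to zero. *)
definition restrict_cols :: "complex ^ 'n ^ 'm \<Rightarrow> 'n set \<Rightarrow> complex ^ 'n ^ 'm" where
  "restrict_cols A S = (\<chi> i j. if j \<in> S then A $ i $ j else 0)"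

definition orc_sol :: "complex ^ 'n ^ 'm \<Rightarrow> 'n set \<Rightarrow> complex ^ 'm \<Rightarrow> complex ^ 'n" where
  "orc_sol A S b = pinv (adjm (restrict_cols A S) ** restrict_cols A S)
                    *v (adjm (restrict_cols A S) *v b)"

end

theory Submission
  imports Defs
begin

(* The oracle solution x' is a least-squares solution on S: it vanishes off S and the residual
  r = b - A x' is orthogonal to the columns of A indexed by S. Hence eps = r + A (x' - x0) is an
  orthogonal decomposition, so |r| <= |eps| and beta_K |x' - x0| <= |A (x' - x0)| <= |eps|.
  Since z' = x' + A^* r, on S we have z'_i = x'_i, which is within |eps| / beta_K of x0_i and hence
  above the interval; off S we have z'_i = (A^* r)_i, of modulus at most |r| < beta_N^2 sqrt mu.
  The one nontrivial ingredient is that the Moore-Penrose inverse of the Gram matrix A_S^* A_S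
  exists and solves the normal equations. *)

lemma adjm_nth [simp]: "adjm C $ i $ j = cnj (C $ j $ i)"
  by (simp add: adjm_def transpose_def)

lemma adjm_adjm [simp]: "adjm (adjm C) = C"
  by (simp add: vec_eq_iff)

lemma adjm_matrix_mult: "adjm ((C :: complex^'n^'m) ** D) = adjm D ** adjm C"
  by (simp add: vec_eq_iff matrix_matrix_mult_def mult.commute)

lemma inner_complex_vec: "inner (x :: complex^'n) y = Re (\<Sum>i\<in>UNIV. x $ i * cnj (y $ i))"
  by (simp add: inner_vec_def inner_complex_def)

lemma inner_adjm_left: "inner (adjm C *v x) y = inner x ((C :: complex^'n^'m) *v y)"
proof -
  have "(\<Sum>j\<in>UNIV. (adjm C *v x) $ j * cnj (y $ j))
      = (\<Sum>j\<in>UNIV. \<Sum>i\<in>UNIV. cnj (C $ i $ j) * x $ i * cnj (y $ j))"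
    by (simp add: matrix_vector_mult_def sum_distrib_right)
  also have "\<dots> = (\<Sum>i\<in>UNIV. \<Sum>j\<in>UNIV. cnj (C $ i $ j) * x $ i * cnj (y $ j))"
    by (rule sum.swap)
  also have "\<dots> = (\<Sum>i\<in>UNIV. x $ i * cnj ((C *v y) $ i))"
    by (simp add: matrix_vector_mult_def sum_distrib_left mult_ac)
  finally show ?thesis
    by (simp add: inner_complex_vec)
qed

definition hermitian :: "complex^'n^'n \<Rightarrow> bool" where
  "hermitian M \<longleftrightarrow> adjm M = M"

lemma hermitian_inner: "hermitian M \<Longrightarrow> inner (M *v x) y = inner x (M *v y)"
  by (metis hermitian_def inner_adjm_left)

lemma hermitianI:
  assumes "\<And>x y. inner (M *v x) y = inner x (M *v y)"
  shows "hermitian M"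
proof -
  have "adjm M *v x = M *v x" for x
  proof -
    have "inner (adjm M *v x - M *v x) y = 0" for y
      by (simp add: inner_diff_left inner_adjm_left assms)
    from this[of "adjm M *v x - M *v x"] show ?thesis
      by simp
  qed
  then show ?thesis
    by (simp add: hermitian_def matrix_eq)
qed

lemma hermitian_gram: "hermitian (adjm B ** B)"
  by (simp add: hermitian_def adjm_matrix_mult)

lemma range_orthogonal_decomp:
  "\<exists>p z. y = p + z \<and> p \<in> range ((*v) (M :: complex^'n^'m)) \<and>
     (\<forall>w \<in> range ((*v) M). inner z w = 0)"
proof -
  have "span (range ((*v) M)) = range ((*v) M)"
    by (simp add: linear_subspace_image)
  then show ?thesis
    using orthogonal_subspace_decomp_exists[of "range ((*v) M)" y]
    unfolding orthogonal_def by metis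
qed

lemma hermitian_range_orthogonal_kernel:
  assumes "hermitian M" "M *v z = 0" "r \<in> range ((*v) M)"
  shows "inner r z = 0"
  using assms hermitian_inner by fastforce

lemma hermitian_orthogonal_range_imp_kernel:
  assumes "hermitian M" "\<forall>w \<in> range ((*v) M). inner z w = 0"
  shows "M *v z = 0"
proof -
  have "inner (M *v z) (M *v z) = inner z (M *v (M *v z))"
    using assms(1) by (rule hermitian_inner)
  also have "\<dots> = 0"
    using assms(2) by simp
  finally show ?thesis
    by simp
qed

lemma hermitian_inj_on_range:
  assumes "hermitian M"
  shows "inj_on ((*v) M) (range ((*v) M))"
proof (rule inj_onI)
  fix r s assume r: "r \<in> range ((*v) M)" and s: "s \<in> range ((*v) M)" and "M *v r = M *v s"
  then have "M *v (r - s) = 0"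
    by (simp add: matrix_vector_mult_diff_distrib)
  moreover have "r - s \<in> range ((*v) M)"
    using r s by (auto simp: matrix_vector_mult_diff_distrib[symmetric])
  ultimately have "inner (r - s) (r - s) = 0"
    using assms hermitian_range_orthogonal_kernel by blast
  then show "r = s"
    by simp
qed

lemma hermitian_exists_range_preimage:
  assumes "hermitian M"
  shows "\<exists>t \<in> range ((*v) M). M *v t = M *v y"
proof -
  obtain p z where "y = p + z" "p \<in> range ((*v) M)" "\<forall>w \<in> range ((*v) M). inner z w = 0"
    using range_orthogonal_decomp by blast
  with hermitian_orthogonal_range_imp_kernel[OF assms] show ?thesis
    by (metis add.right_neutral matrix_vector_right_distrib)
qed

definition penrose :: "complex^'n^'m \<Rightarrow> complex^'m^'n \<Rightarrow> bool" where
  "penrose M X \<longleftrightarrow> M ** X ** M = M \<and> X ** M ** X = X \<and>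
     adjm (M ** X) = M ** X \<and> adjm (X ** M) = X ** M"

lemma penrose_unique:
  assumes "penrose M X" "penrose M Y"
  shows "X = Y"
proof -
  from assms have
    X: "M ** X ** M = M" "X ** M ** X = X" "adjm (M ** X) = M ** X" "adjm (X ** M) = X ** M"
    and Y: "M ** Y ** M = M" "Y ** M ** Y = Y" "adjm (M ** Y) = M ** Y" "adjm (Y ** M) = Y ** M"
    by (simp_all add: penrose_def)
  have MX: "M ** X = M ** Y"
  proof -
    have "M ** X = (M ** Y) ** (M ** X)"
      by (metis Y(1) matrix_mul_assoc)
    also have "\<dots> = adjm ((M ** X) ** (M ** Y))"
      by (subst adjm_matrix_mult) (simp only: X(3) Y(3))
    also have "\<dots> = M ** Y"
      by (metis X(1) Y(3) matrix_mul_assoc)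
    finally show ?thesis .
  qed
  have XM: "X ** M = Y ** M"
  proof -
    have "X ** M = (X ** M) ** (Y ** M)"
      by (metis Y(1) matrix_mul_assoc)
    also have "\<dots> = adjm ((Y ** M) ** (X ** M))"
      by (subst adjm_matrix_mult) (simp only: X(4) Y(4))
    also have "\<dots> = Y ** M"
      by (metis X(1) Y(4) matrix_mul_assoc)
    finally show ?thesis .
  qed
  have "X = (X ** M) ** X"
    by (simp only: X(2))
  also have "\<dots> = Y ** (M ** Y)"
    by (metis MX XM matrix_mul_assoc)
  also have "\<dots> = Y"
    by (metis Y(2) matrix_mul_assoc)
  finally show ?thesis .
qed

lemma pinv_eqI: "penrose M X \<Longrightarrow> pinv M = X"
  unfolding pinv_def penrose_def[symmetric] by (blast intro: penrose_unique)

lemma hermitian_range_left_inverse: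
  assumes "hermitian M"
  obtains g where "Vector_Spaces.linear (*s) (*s) g" "range g \<subseteq> range ((*v) M)"
    "\<And>r. r \<in> range ((*v) M) \<Longrightarrow> g (M *v r) = r"
proof -
  have "vec.subspace (range ((*v) M))"
    by (simp add: vec.subspace_image)
  with vec.linear_exists_left_inverse_on[OF _ _ hermitian_inj_on_range[OF assms]] that
  show ?thesis
    by blast
qed

lemma hermitian_left_inverse_projection:
  assumes "hermitian M" and g_range: "range g \<subseteq> range ((*v) M)"
    and g_inv: "\<And>r. r \<in> range ((*v) M) \<Longrightarrow> g (M *v r) = r"
  shows "M *v g (M *v y) = M *v y" and "inner (g (M *v x)) y = inner x (g (M *v y))"
proof -
  show kernel: "M *v g (M *v y) = M *v y" for y
  proof -
    obtain t where "t \<in> range ((*v) M)" "M *v t = M *v y"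
      using hermitian_exists_range_preimage[OF assms(1)] by blast
    with g_inv show ?thesis
      by metis
  qed
  have "inner (g (M *v u)) (v - g (M *v v)) = 0" for u v
    using hermitian_range_orthogonal_kernel[OF assms(1)] g_range kernel
    by (simp add: matrix_vector_mult_diff_distrib subset_iff)
  then have "inner (g (M *v u)) v = inner (g (M *v u)) (g (M *v v))" for u v
    by (simp add: inner_diff_right)
  then show "inner (g (M *v x)) y = inner x (g (M *v y))"
    by (metis inner_commute)
qed

lemma hermitian_penrose_exists:
  assumes "hermitian M"
  shows "\<exists>X. penrose M X"
proof -
  obtain g where g_linear: "Vector_Spaces.linear (*s) (*s) g"
    and g_range: "range g \<subseteq> range ((*v) M)"
    and g_inv: "\<And>r. r \<in> range ((*v) M) \<Longrightarrow> g (M *v r) = r"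
    using hermitian_range_left_inverse[OF assms] by blast
  note projection = hermitian_left_inverse_projection[OF assms g_range g_inv]
  (* M maps its range R onto R, so g (g (M y)) is the inverse of M on R applied to the
    orthogonal projection g (M y) of y onto R. *)
  define X where "X = matrix g ** matrix g ** M"
  have X: "X *v y = g (g (M *v y))" for y
    by (simp add: X_def matrix_works[OF g_linear] matrix_vector_mul_assoc[symmetric])
  have MX: "M *v (X *v y) = g (M *v y)" for y
  proof -
    obtain v where v: "g (M *v y) = M *v v"
      using g_range by blast
    then show ?thesis
      by (simp add: X projection(1))
  qed
  have XM: "X *v (M *v y) = g (M *v y)" for y
    by (simp add: X g_inv)
  have "M ** X ** M = M"
    by (simp add: matrix_eq matrix_vector_mul_assoc[symmetric] MX g_inv)
  moreover have "X ** M ** X = X"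
    using g_range by (simp add: matrix_eq matrix_vector_mul_assoc[symmetric] XM X g_inv subset_iff)
  moreover have "adjm (M ** X) = M ** X" "adjm (X ** M) = X ** M"
    using hermitianI[of "M ** X"] hermitianI[of "X ** M"] projection(2)
    by (simp_all add: matrix_vector_mul_assoc[symmetric] MX XM hermitian_def)
  ultimately show ?thesis
    unfolding penrose_def by blast
qed

lemma hermitian_penrose_pinv: "hermitian M \<Longrightarrow> penrose M (pinv M)"
  using hermitian_penrose_exists pinv_eqI by metis

lemma penrose_inverse_on_range:
  assumes "penrose M X" "q \<in> range ((*v) M)"
  shows "M *v (X *v q) = q"
proof -
  obtain w where "q = M *v w"
    using assms(2) by blast
  with assms(1) show ?thesis
    by (simp add: penrose_def matrix_vector_mul_assoc matrix_mul_assoc)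
qed

lemma hermitian_penrose_mult_in_range:
  assumes "hermitian M" "penrose M X"
  shows "X *v q \<in> range ((*v) M)"
proof -
  have "X = (X ** M) ** X"
    using assms(2) by (simp add: penrose_def)
  also have "X ** M = M ** adjm X"
    using assms by (metis penrose_def hermitian_def adjm_matrix_mult)
  finally have "X *v q = M *v ((adjm X ** X) *v q)"
    by (metis matrix_vector_mul_assoc matrix_mul_assoc)
  then show ?thesis
    by blast
qed

lemma adjm_mult_vec_in_gram_range: "adjm B *v b \<in> range ((*v) (adjm B ** B))"
proof -
  let ?G = "adjm B ** B"
  obtain p z where decomp: "adjm B *v b = p + z" "p \<in> range ((*v) ?G)"
    and z_orth: "\<forall>w \<in> range ((*v) ?G). inner z w = 0"
    using range_orthogonal_decomp by blast
  have "?G *v z = 0"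
    using hermitian_orthogonal_range_imp_kernel[OF hermitian_gram z_orth] .
  then have "inner (B *v z) (B *v z) = 0"
    by (metis inner_adjm_left inner_zero_left matrix_vector_mul_assoc)
  then have "inner (adjm B *v b) z = 0"
    by (simp add: inner_adjm_left)
  moreover have "inner p z = 0"
    using z_orth decomp(2) by (auto simp: inner_commute)
  ultimately have "z = 0"
    by (simp add: decomp(1) inner_add_left)
  with decomp show ?thesis
    by simp
qed

lemma restrict_cols_mult_vec:
  "(\<And>i. i \<notin> S \<Longrightarrow> v $ i = 0) \<Longrightarrow> restrict_cols A S *v v = A *v v"
  by (auto simp: vec_eq_iff matrix_vector_mult_def restrict_cols_def intro!: sum.cong)

lemma adjm_restrict_cols_mult_vec_nth:
  "(adjm (restrict_cols A S) *v r) $ i = (if i \<in> S then (adjm A *v r) $ i else 0)"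
  by (simp add: matrix_vector_mult_def restrict_cols_def)

lemma orc_sol_supp:
  assumes "i \<notin> S"
  shows "orc_sol A S b $ i = 0"
proof -
  let ?B = "restrict_cols A S"
  have "orc_sol A S b \<in> range ((*v) (adjm ?B ** ?B))"
    unfolding orc_sol_def by (intro hermitian_penrose_mult_in_range hermitian_gram hermitian_penrose_pinv)
  with assms show ?thesis
    by (auto simp: matrix_vector_mul_assoc[symmetric] adjm_restrict_cols_mult_vec_nth)
qed

lemma orc_sol_normal_equation:
  "adjm (restrict_cols A S) *v (b - A *v orc_sol A S b) = 0"
proof -
  let ?B = "restrict_cols A S"
  have "(adjm ?B ** ?B) *v orc_sol A S b = adjm ?B *v b"
    unfolding orc_sol_def
    by (intro penrose_inverse_on_range hermitian_penrose_pinv hermitian_gram adjm_mult_vec_in_gram_range)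
  moreover have "A *v orc_sol A S b = ?B *v orc_sol A S b"
    by (simp add: restrict_cols_mult_vec orc_sol_supp)
  ultimately show ?thesis
    by (simp add: matrix_vector_mult_diff_distrib matrix_vector_mul_assoc)
qed

lemma norm_le_add_adjm_kernel:
  assumes "adjm B *v r = 0"
  shows "norm r \<le> norm (r + B *v d)" "norm (B *v d) \<le> norm (r + B *v d)"
proof -
  have "inner r (B *v d) = 0"
    using assms by (simp flip: inner_adjm_left)
  then have "(norm (r + B *v d))\<^sup>2 = (norm r)\<^sup>2 + (norm (B *v d))\<^sup>2"
    by (simp add: norm_add_Pythagorean orthogonal_def)
  then show "norm r \<le> norm (r + B *v d)" "norm (B *v d) \<le> norm (r + B *v d)"
    by (simp_all add: power2_le_imp_le)
qed

lemma orc_sol_error_le_noise: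
  assumes "\<And>i. i \<notin> S \<Longrightarrow> x0 $ i = 0" and "b = A *v x0 + eps"
  shows "norm (b - A *v orc_sol A S b) \<le> norm eps"
    and "norm (A *v (orc_sol A S b - x0)) \<le> norm eps"
proof -
  let ?B = "restrict_cols A S" and ?x = "orc_sol A S b"
  have B_eq: "?B *v (?x - x0) = A *v (?x - x0)"
    by (rule restrict_cols_mult_vec) (simp add: assms(1) orc_sol_supp)
  have "eps = (b - A *v ?x) + ?B *v (?x - x0)"
    unfolding B_eq by (simp add: assms(2) matrix_vector_mult_diff_distrib)
  then show "norm (b - A *v ?x) \<le> norm eps" "norm (A *v (?x - x0)) \<le> norm eps"
    using norm_le_add_adjm_kernel[OF orc_sol_normal_equation[of A S b], of "?x - x0"] B_eq
    by simp_all
qed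

lemma orc_sol_step_nth:
  "((mat 1 - adjm A ** A) *v orc_sol A S b + adjm A *v b) $ i =
     (if i \<in> S then orc_sol A S b $ i else (adjm A *v (b - A *v orc_sol A S b)) $ i)"
proof -
  have "(mat 1 - adjm A ** A) *v orc_sol A S b + adjm A *v b
      = orc_sol A S b + adjm A *v (b - A *v orc_sol A S b)"
    by (simp add: matrix_vector_mult_diff_rdistrib matrix_vector_mult_diff_distrib
        matrix_vector_mul_assoc)
  moreover have "(adjm A *v (b - A *v orc_sol A S b)) $ i = 0" if "i \<in> S"
    using that orc_sol_normal_equation[THEN arg_cong, of "\<lambda>v. v $ i" A S b]
    by (simp add: adjm_restrict_cols_mult_vec_nth)
  ultimately show ?thesis
    by (simp add: orc_sol_supp)
qed

lemma beta_le_ratio: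
  assumes "in_field F x" "x \<noteq> 0" "cardv x \<le> k"
  shows "beta F A k \<le> norm (A *v x) / norm x"
  unfolding beta_def by (rule cInf_lower) (use assms in \<open>auto intro!: bdd_belowI[of _ 0]\<close>)

lemma beta_mult_norm_le_in_field:
  assumes "in_field F x" "cardv x \<le> k" "beta F A k \<ge> 0"
  shows "beta F A k * norm x \<le> norm (A *v x)"
proof (cases "x = 0")
  case False
  with beta_le_ratio[OF assms(1) False assms(2)] show ?thesis
    by (simp add: pos_le_divide_eq)
qed (use assms in simp)

lemma cardv_mono: "(\<And>i. w $ i = 0 \<Longrightarrow> v $ i = 0) \<Longrightarrow> cardv v \<le> cardv w"
  unfolding cardv_def by (rule card_mono) auto

lemma cardv_le_card: "(\<And>i. i \<notin> S \<Longrightarrow> v $ i = 0) \<Longrightarrow> cardv v \<le> card S"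
  unfolding cardv_def by (rule card_mono) auto

lemma in_field_real_mult_vec:
  "mat_in_field \<real> A \<Longrightarrow> in_field \<real> u \<Longrightarrow> in_field \<real> (A *v u)"
  by (auto simp: in_field_def mat_in_field_def matrix_vector_mult_def)

lemma norm_real_add_imag:
  assumes "in_field \<real> u" "in_field \<real> v"
  shows "(norm (u + \<i> *s v))\<^sup>2 = (norm u)\<^sup>2 + (norm (v :: complex^'n))\<^sup>2"
proof -
  have "Im (u $ i) = 0" "Im (v $ i) = 0" for i
    using assms by (auto simp: in_field_def complex_is_Real_iff)
  then show ?thesis
    by (simp add: power2_norm_eq_inner inner_vec_def inner_complex_def sum.distrib)
qed

lemma beta_mult_norm_le:
  assumes "F = \<real> \<or> F = UNIV" "mat_in_field F A" "cardv w \<le> k" "beta F A k \<ge> 0"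
  shows "beta F A k * norm w \<le> norm (A *v w)"
  using assms(1)
proof
  assume "F = UNIV"
  then show ?thesis
    using beta_mult_norm_le_in_field[of F w k A] assms(3,4) by (simp add: in_field_def)
next
  (* beta then only controls real vectors: split w into real and imaginary parts. *)
  assume F: "F = \<real>"
  define u where "u = (\<chi> j. complex_of_real (Re (w $ j)))"
  define v where "v = (\<chi> j. complex_of_real (Im (w $ j)))"
  have w: "w = u + \<i> *s v"
    by (simp add: u_def v_def vec_eq_iff complex_eq_iff)
  have u_real: "in_field \<real> u" and v_real: "in_field \<real> v"
    by (auto simp: in_field_def u_def v_def)
  have "cardv u \<le> k" "cardv v \<le> k"
    using cardv_mono[of w u] cardv_mono[of w v] assms(3) by (auto simp: u_def v_def)
  then have bound_u: "beta F A k * norm u \<le> norm (A *v u)"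
    and bound_v: "beta F A k * norm v \<le> norm (A *v v)"
    using beta_mult_norm_le_in_field u_real v_real assms(4) F by auto
  have A_real: "mat_in_field \<real> A"
    using assms(2) F by simp
  have "(beta F A k * norm w)\<^sup>2 = (beta F A k * norm u)\<^sup>2 + (beta F A k * norm v)\<^sup>2"
    by (simp add: w norm_real_add_imag[OF u_real v_real] power_mult_distrib distrib_left)
  also have "\<dots> \<le> (norm (A *v u))\<^sup>2 + (norm (A *v v))\<^sup>2"
    using bound_u bound_v assms(4) by (intro add_mono power_mono) auto
  also have "\<dots> = (norm (A *v w))\<^sup>2"
    using norm_real_add_imag[OF in_field_real_mult_vec[OF A_real u_real]
        in_field_real_mult_vec[OF A_real v_real]]
    by (simp add: w matrix_vector_right_distrib vec.scale)
  finally have "(beta F A k * norm w)\<^sup>2 \<le> (norm (A *v w))\<^sup>2" .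
  then show ?thesis
    by (rule power2_le_imp_le) simp
qed

lemma beta_mult_orc_sol_error_le_noise:
  assumes "F = \<real> \<or> F = UNIV" "mat_in_field F A" "beta F A (card S) \<ge> 0"
    and "\<And>i. i \<notin> S \<Longrightarrow> x0 $ i = 0" "b = A *v x0 + eps"
  shows "beta F A (card S) * norm (orc_sol A S b - x0) \<le> norm eps"
proof -
  have "cardv (orc_sol A S b - x0) \<le> card S"
    by (rule cardv_le_card) (simp add: orc_sol_supp assms(4))
  with beta_mult_norm_le[OF assms(1,2)] assms(3) orc_sol_error_le_noise(2)[OF assms(4,5)]
  show ?thesis
    by (meson order_trans)
qed

lemma norm_adjm_mult_vec_nth_le: "cmod ((adjm A *v r) $ i) \<le> col_inf_norm A * norm r"
proof -
  have "cmod ((adjm A *v r) $ i) \<le> (\<Sum>k\<in>UNIV. cmod (A $ k $ i) * cmod (r $ k))"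
    unfolding matrix_vector_mult_def by (auto intro: order_trans[OF norm_sum] simp: norm_mult)
  also have "\<dots> \<le> L2_set (\<lambda>k. cmod (A $ k $ i)) UNIV * L2_set (\<lambda>k. cmod (r $ k)) UNIV"
    using L2_set_mult_ineq[of "\<lambda>k. cmod (A $ k $ i)" "\<lambda>k. cmod (r $ k)" UNIV] by simp
  also have "\<dots> = norm (column i A) * norm r"
    by (simp add: norm_vec_def column_def)
  also have "\<dots> \<le> col_inf_norm A * norm r"
    unfolding col_inf_norm_def by (intro mult_right_mono Max_ge) auto
  finally show ?thesis .
qed

theorem proposition4p7:
  fixes F :: "complex set"
    and A :: "complex ^ 'n ^ 'm"
    and x0 :: "complex ^ 'n"
    and eps b :: "complex ^ 'm"
    and mu :: real and N K :: nat and S :: "'n set"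
  assumes hF: "F = \<real> \<or> F = UNIV"
    and hA: "mat_in_field F A" and hx0: "in_field F x0" and heps: "in_field F eps"
    and hcol: "col_inf_norm A \<le> 1"
    and hmu: "mu > 0"
    and hS: "S = supp x0" and hK: "card S = K"
    and hb: "b = A *v x0 + eps"
    and hN: "N \<ge> 1" and hbN: "beta F A N > 0" and hbK: "beta F A K > 0"
    and heps_small: "norm eps < (beta F A N)\<^sup>2 * sqrt mu"
    and hx0_large: "\<forall>j\<in>S. cmod (x0 $ j) >
        sqrt mu / (beta F A N)\<^sup>2 + (beta F A N)\<^sup>2 * sqrt mu / beta F A K"
  shows "let x' = orc_sol A S b;
             z' = (mat 1 - adjm A ** A) *v x' + adjm A *v b
         in \<forall>i. cmod (z' $ i) \<notin> {(beta F A N)\<^sup>2 * sqrt mu .. sqrt mu / (beta F A N)\<^sup>2}"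
proof -
  define x' where "x' = orc_sol A S b"
  have x0_supp: "x0 $ i = 0" if "i \<notin> S" for i
    using that hS by (simp add: supp_def)
  have residual_small: "norm (b - A *v x') < (beta F A N)\<^sup>2 * sqrt mu"
    using orc_sol_error_le_noise(1)[where S = S, OF x0_supp hb] heps_small by (simp add: x'_def)
  have "beta F A K * norm (x' - x0) < (beta F A N)\<^sup>2 * sqrt mu"
    using beta_mult_orc_sol_error_le_noise[where S = S, OF hF hA _ x0_supp hb] hK hbK heps_small
    by (simp add: x'_def)
  then have error_small: "norm (x' - x0) < (beta F A N)\<^sup>2 * sqrt mu / beta F A K"
    using hbK by (simp add: pos_less_divide_eq mult.commute)
  have step: "((mat 1 - adjm A ** A) *v x' + adjm A *v b) $ i
      = (if i \<in> S then x' $ i else (adjm A *v (b - A *v x')) $ i)" for i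
    unfolding x'_def by (rule orc_sol_step_nth)
  have "cmod (((mat 1 - adjm A ** A) *v x' + adjm A *v b) $ i)
      \<notin> {(beta F A N)\<^sup>2 * sqrt mu .. sqrt mu / (beta F A N)\<^sup>2}" for i
  proof (cases "i \<in> S")
    case True
    have "cmod (x0 $ i) \<le> cmod (x' $ i) + norm (x' - x0)"
      using norm_triangle_ineq4[of "x' $ i" "(x' - x0) $ i"]
        Finite_Cartesian_Product.norm_nth_le[of "x' - x0" i] by simp
    moreover have "cmod (x0 $ i) > sqrt mu / (beta F A N)\<^sup>2 + (beta F A N)\<^sup>2 * sqrt mu / beta F A K"
      using hx0_large True by blast
    ultimately have "cmod (x' $ i) > sqrt mu / (beta F A N)\<^sup>2"
      using error_small by linarith
    then show ?thesis
      unfolding step using True by simp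
  next
    case False
    have "cmod ((adjm A *v (b - A *v x')) $ i) \<le> norm (b - A *v x')"
      using norm_adjm_mult_vec_nth_le[of A "b - A *v x'" i]
        mult_right_mono[OF hcol, of "norm (b - A *v x')"] by simp
    then show ?thesis
      unfolding step using False residual_small by simp
  qed
  then show ?thesis
    unfolding Let_def x'_def by blast
qed

end
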